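(* For every positive integer $n$, $\delta(n)=\tau(n)$. Moreover, for every positive integer $n$ there exists a subforest $S$ of $\mathcal{T}_\infty$ such that $|S|=n$, $|(S,\overline S)|=\tau(n)$, and all the trees in the forest $S$, except possibly one, are complete binary trees. If $(P,N)$ is a minimal SABP of $n$ in normal form, then the subforest obtained by taking the disjoint union of the C-tree of $(\{\max P\},N)$ and the P-forest of $(P\setminus\{\max P\},\emptyset)$ is such a subforest.
   Context: $\mathcal{T}_\infty$ is the infinite binary tree with all leaves at the same level: its vertices are the pairs $(i,j)$ of integers with $i\ge 1$, $j\ge 0$; the vertex $(i,j)$ has parent $(i+1,\lfloor j/2\rfloor)$, and the edges join each vertex to its parent. The vertex $(i,j)$ is at level (height) $i$; vertices at level $1$ are the leaves, and each vertex $(i,j)$ with $i\ge 2$ has a left child $(i-1,2j)$ and a right child $(i-1,2j+1)$. For a finite vertex set $S$, $\overline S$ is its complement and $(S,\overline S)$ is the set of edges with one end in $S$ and the other in $\overline S$. $\delta(n)=\min\{|(S,\overline S)| : S\subset V(\mathcal{T}_\infty),\ |S|=n\}$. A subforest is identified with its (induced) vertex set. Write $\nu_\ell=\nu(\ell)=2^\ell-1$, and for a finite multiset $P$ of positive integers $\nu(P)=\sum_{i\in P}\nu_i$ (with multiplicity). A signed almost binary partition (SABP) of $n$ is a pair $(P,N)$ of finite multisets of positive integers with $n=\nu(P)-\nu(N)$; its number of parts is $|(P,N)|=|P|+|N|$. $\tau(n)$ is the least number of parts in any SABP of $n$; an SABP attaining it is called minimal. A CABP is an SABP with $|P|=1$;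 an ABP is an SABP with $N=\emptyset$. $\mathrm{Greedy}(m)$ is the multiset of exponents obtained by successively subtracting from $m$ the largest number of the form $2^k-1$, $k\geq 1$, that is at most the current remainder until $0$ is reached ($\mathrm{Greedy}(0)=\emptyset$). An SABP $(P,N)$ of $n$ is in normal form if (A) $P\cap N=\emptyset$; (B) $P=\mathrm{Greedy}(\nu(P))$ and $N=\mathrm{Greedy}(\nu(N))$; (C) $\max(P)\in\{\lfloor\log_2 n\rfloor,1+\lfloor\log_2 n\rfloor\}$. $P\setminus\{\max P\}$ means removing one copy of $\max P$. P-forest of an ABP $(P,\emptyset)$: the forest induced in $\mathcal{T}_\infty$ that is a disjoint union of $|P|$ complete binary trees, having for each $t$ in the multiset $P$ one tree of size $2^t-1$ with its root at level $t$ and all its leaves at the lowest level (level $1$) of $\mathcal{T}_\infty$. C-tree of a CABP $(\{r\},N)$ of a positive integer, where $N=\mathrm{Greedy}(\nu(N))$ (so only the smallest element of $N$ can repeat, and at most twice): start with the subtree of $\mathcal{T}_\infty$ consisting of a vertex $v_r$ at level $r$ and all its descendants. If $N$ has no repeated element let $h=1$; otherwise let $h=t+1$ where $t=\min N$ is the repeated element. Define a path $v_r,v_{r-1},\dots,v_h$ by: for $r\ge j\ge h+1$, $v_{j-1}$ is the right child of $v_j$ if $j-1\notin N$, and the left child of $v_j$ if $j-1\in N$. For $j=r,\dots,h+1$, whenever $v_{j-1}$ is the left child of $v_j$, delete the whole subtree rooted at the right child of $v_j$. Finally, if $h\ne 1$, delete the subtrees rooted at both children of $v_h$. What remains is the C-tree.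 Disjoint union of such trees/forests in $\mathcal{T}_\infty$ means that they are placed on disjoint vertex sets of $\mathcal{T}_\infty$ with no edge of $\mathcal{T}_\infty$ between distinct trees. *)

theory Defs
  imports Complex_Main "HOL-Library.Multiset"
begin

section \<open>The infinite binary tree\<close>

type_synonym vertex = "nat \<times> nat"

definition verts :: "vertex set" where
  "verts = {(i, j). 1 \<le> i}"

definition parent :: "vertex \<Rightarrow> vertex" where
  "parent v = (fst v + 1, snd v div 2)"

text \<open>On leaves the truncated subtraction gives level \<open>0\<close>, that is, no vertex of the tree.\<close>

definition left_child :: "vertex \<Rightarrow> vertex" where
  "left_child v = (fst v - 1, 2 * snd v)"

definition right_child :: "vertex \<Rightarrow> vertex" where
  "right_child v = (fst v - 1, 2 * snd v + 1)"

definition edges :: "vertex set set" where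
  "edges = {{v, parent v} | v. v \<in> verts}"

definition cut :: "vertex set \<Rightarrow> vertex set set" where
  "cut S = {e \<in> edges. \<exists>u \<in> S. \<exists>w \<in> verts - S. e = {u, w}}"

definition delta :: "nat \<Rightarrow> nat" where
  "delta n = (LEAST k. \<exists>S. S \<subseteq> verts \<and> finite S \<and> card S = n \<and> card (cut S) = k)"

text \<open>A vertex together with all its descendants.\<close>

definition subtree_at :: "vertex \<Rightarrow> vertex set" where
  "subtree_at v = {w \<in> verts. \<exists>k. (parent ^^ k) w = v}"


section \<open>Subforests\<close>

text \<open>A subforest is identified with its vertex set; its trees are the connected components of the
  induced subgraph.\<close>

definition induced_adj :: "vertex set \<Rightarrow> vertex rel" where
  "induced_adj S = {(u, w). u \<in> S \<and> w \<in> S \<and> {u, w} \<in> edges}"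

definition trees_of :: "vertex set \<Rightarrow> vertex set set" where
  "trees_of S = S // (induced_adj S)\<^sup>*"

definition is_subtree :: "vertex set \<Rightarrow> bool" where
  "is_subtree T \<longleftrightarrow> T \<subseteq> verts \<and> finite T \<and> T \<noteq> {} \<and> (\<forall>u \<in> T. \<forall>w \<in> T. (u, w) \<in> (induced_adj T)\<^sup>*)"

text \<open>Root and leaves are meant with respect to the parent relation inherited from the
  infinite tree, so the leaves of a subtree need not be at level \<open>1\<close>.\<close>

definition is_root :: "vertex set \<Rightarrow> vertex \<Rightarrow> bool" where
  "is_root T v \<longleftrightarrow> v \<in> T \<and> parent v \<notin> T"

definition leaves :: "vertex set \<Rightarrow> vertex set" where
  "leaves T = {v \<in> T. left_child v \<notin> T \<and> right_child v \<notin> T}"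

definition complete_binary_tree :: "vertex set \<Rightarrow> bool" where
  "complete_binary_tree T \<longleftrightarrow> is_subtree T
     \<and> (\<forall>v \<in> T. left_child v \<in> T \<longleftrightarrow> right_child v \<in> T)
     \<and> (\<forall>u \<in> leaves T. \<forall>w \<in> leaves T. fst u = fst w)"

definition separated :: "vertex set \<Rightarrow> vertex set \<Rightarrow> bool" where
  "separated A B \<longleftrightarrow> A \<inter> B = {} \<and> (\<forall>u \<in> A. \<forall>w \<in> B. {u, w} \<notin> edges)"


section \<open>Signed almost binary partitions\<close>

definition nu :: "nat \<Rightarrow> nat" where
  "nu l = 2 ^ l - 1"

definition nu_mset :: "nat multiset \<Rightarrow> nat" where
  "nu_mset P = (\<Sum>i\<in>#P. nu i)"

definition sabp :: "nat \<Rightarrow> nat multiset \<Rightarrow> nat multiset \<Rightarrow> bool" where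
  "sabp n P N \<longleftrightarrow> (\<forall>i \<in># P. 1 \<le> i) \<and> (\<forall>i \<in># N. 1 \<le> i)
     \<and> int n = int (nu_mset P) - int (nu_mset N)"

definition tau :: "nat \<Rightarrow> nat" where
  "tau n = (LEAST k. \<exists>P N. sabp n P N \<and> size P + size N = k)"

definition minimal_sabp :: "nat \<Rightarrow> nat multiset \<Rightarrow> nat multiset \<Rightarrow> bool" where
  "minimal_sabp n P N \<longleftrightarrow> sabp n P N \<and> size P + size N = tau n"

definition largest_exponent :: "nat \<Rightarrow> nat" where
  "largest_exponent m = (GREATEST k. 1 \<le> k \<and> nu k \<le> m)"

lemma largest_exponent:
  assumes "0 < m"
  shows "1 \<le> largest_exponent m" "nu (largest_exponent m) \<le> m"
proof -
  have bound: "k \<le> m" if "1 \<le> k \<and> nu k \<le> m" for k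
  proof -
    have "k < 2 ^ k" by (rule less_exp)
    moreover have "2 ^ k \<le> m + 1" using that by (auto simp: nu_def)
    ultimately show ?thesis by linarith
  qed
  have "1 \<le> (1::nat) \<and> nu 1 \<le> m" using assms by (simp add: nu_def)
  from GreatestI_nat[where P = "\<lambda>k. 1 \<le> k \<and> nu k \<le> m", OF this bound]
  show "1 \<le> largest_exponent m" "nu (largest_exponent m) \<le> m"
    by (simp_all add: largest_exponent_def)
qed

lemma nu_pos: "1 \<le> k \<Longrightarrow> 0 < nu k"
  using one_less_power[of "2::nat" k] by (simp add: nu_def)

function greedy :: "nat \<Rightarrow> nat multiset" where
  "greedy m = (if m = 0 then {#}
     else add_mset (largest_exponent m) (greedy (m - nu (largest_exponent m))))"
  by auto
termination
proof (relation "measure id")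
  fix m :: nat
  assume "m \<noteq> 0"
  then show "(m - nu (largest_exponent m), m) \<in> measure id"
    using nu_pos[OF largest_exponent(1), of m] by simp
qed simp

declare greedy.simps [simp del]

definition normal_form :: "nat \<Rightarrow> nat multiset \<Rightarrow> nat multiset \<Rightarrow> bool" where
  "normal_form n P N \<longleftrightarrow> P \<inter># N = {#}
     \<and> P = greedy (nu_mset P) \<and> N = greedy (nu_mset N)
     \<and> int (Max_mset P) \<in> {\<lfloor>log 2 (real n)\<rfloor>, 1 + \<lfloor>log 2 (real n)\<rfloor>}"


section \<open>P-forests and C-trees\<close>

text \<open>Both depend on where they are placed in the infinite tree: \<open>p_forest P F\<close> says that
  \<open>F\<close> is some placement of the P-forest of \<open>(P, {#})\<close>. Since its trees are disjoint and nonempty,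
  they form a set \<open>\<T>\<close>, and \<open>t\<close> gives the level of the root of each of them.\<close>

definition p_forest :: "nat multiset \<Rightarrow> vertex set \<Rightarrow> bool" where
  "p_forest P F \<longleftrightarrow> (\<exists>\<T> t. finite \<T> \<and> F = \<Union>\<T> \<and> pairwise separated \<T>
     \<and> image_mset t (mset_set \<T>) = P
     \<and> (\<forall>T \<in> \<T>. complete_binary_tree T \<and> card T = 2 ^ t T - 1
          \<and> (\<forall>v. is_root T v \<longrightarrow> fst v = t T) \<and> (\<forall>v \<in> leaves T. fst v = 1)))"

definition c_bottom :: "nat multiset \<Rightarrow> nat" where
  "c_bottom N = (if \<forall>i. count N i \<le> 1 then 1 else Min_mset N + 1)"

text \<open>\<open>c_path N v k\<close> is the vertex reached after \<open>k\<close> downward steps from \<open>v\<close>; if \<open>v\<close> is at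
  level \<open>r\<close>, this is the path vertex at level \<open>r - k\<close>.\<close>

primrec c_path :: "nat multiset \<Rightarrow> vertex \<Rightarrow> nat \<Rightarrow> vertex" where
  "c_path N v 0 = v"
| "c_path N v (Suc k) =
     (if fst (c_path N v k) - 1 \<in># N then left_child (c_path N v k) else right_child (c_path N v k))"

text \<open>The C-tree of \<open>({#r#}, N)\<close> with root \<open>(r, m)\<close>.\<close>

definition c_tree :: "nat \<Rightarrow> nat multiset \<Rightarrow> nat \<Rightarrow> vertex set" where
  "c_tree r N m =
     (let h = c_bottom N; p = (\<lambda>j. c_path N (r, m) (r - j)) in
      subtree_at (r, m)
      - (\<Union>j \<in> {j. h + 1 \<le> j \<and> j \<le> r \<and> p (j - 1) = left_child (p j)}. subtree_at (right_child (p j)))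
      - (if h \<noteq> 1 then subtree_at (left_child (p h)) \<union> subtree_at (right_child (p h)) else {}))"

definition union_c_tree_p_forest :: "nat multiset \<Rightarrow> nat multiset \<Rightarrow> vertex set \<Rightarrow> bool" where
  "union_c_tree_p_forest P N S \<longleftrightarrow> (\<exists>m F. p_forest (P - {#Max_mset P#}) F
     \<and> separated (c_tree (Max_mset P) N m) F \<and> S = c_tree (Max_mset P) N m \<union> F)"

definition optimal_subforest :: "nat \<Rightarrow> vertex set \<Rightarrow> bool" where
  "optimal_subforest n S \<longleftrightarrow> S \<subseteq> verts \<and> finite S \<and> card S = n \<and> card (cut S) = tau n
     \<and> (\<exists>T0. \<forall>T \<in> trees_of S. T \<noteq> T0 \<longrightarrow> complete_binary_tree T)"

end

theory Submission
  imports Defs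
begin

text \<open>Since \<open>\<nu>(i) = 1 + 2 \<nu>(i - 1)\<close>, summing \<open>\<nu>\<close>(level) over the vertices of a finite set \<open>S\<close> and
  subtracting the same sum over their children leaves \<open>|S|\<close>. The edges inside \<open>S\<close> cancel, so the
  boundary edges of \<open>S\<close>, weighted by \<open>\<plusminus>\<nu>\<close>(level of the lower end), form an SABP of \<open>|S|\<close>: this gives
  \<open>\<tau> \<le> \<delta>\<close>. The same identity computes the size of the C-tree and of the complete trees from their
  boundaries alone. For the converse, greedy partitions have the fewest parts among all ABPs, so
  both halves of a minimal SABP may be taken greedy; then every part of \<open>N\<close> is smaller than \<open>max P\<close>,
  which is what the C-tree needs.\<close>


section \<open>Greedy partitions\<close>

lemma nu_0 [simp]: "nu 0 = 0"
  by (simp add: nu_def)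

lemma nu_Suc: "nu (Suc k) = 2 * nu k + 1"
proof -
  have "(1::nat) \<le> 2 ^ k" by simp
  then show ?thesis unfolding nu_def power_Suc by linarith
qed

lemma nu_mono: "i \<le> j \<Longrightarrow> nu i \<le> nu j"
  by (simp add: nu_def diff_le_mono power_increasing)

lemma nu_less_iff: "nu i < nu j \<longleftrightarrow> i < j"
proof
  assume "i < j"
  then have "nu (Suc i) \<le> nu j" by (intro nu_mono) simp
  then show "nu i < nu j" by (simp add: nu_Suc)
next
  assume "nu i < nu j"
  then show "i < j" using nu_mono[of j i] by (meson leD leI)
qed

lemma nu_mset_empty [simp]: "nu_mset {#} = 0"
  by (simp add: nu_mset_def)

lemma nu_mset_add [simp]: "nu_mset (add_mset k M) = nu k + nu_mset M"
  by (simp add: nu_mset_def)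

lemma nu_le_nu_mset: "i \<in># M \<Longrightarrow> nu i \<le> nu_mset M"
  by (metis insert_DiffM le_add1 nu_mset_add)

lemma largest_exponent_eqI:
  assumes "1 \<le> k" "nu k \<le> m" "m < nu (Suc k)"
  shows "largest_exponent m = k"
  unfolding largest_exponent_def
proof (rule Greatest_equality)
  show "1 \<le> k \<and> nu k \<le> m" using assms by simp
next
  fix y assume "1 \<le> y \<and> nu y \<le> m"
  then have "nu y < nu (Suc k)" using assms by simp
  then show "y \<le> k" by (simp add: nu_less_iff)
qed

lemma less_nu_Suc_largest_exponent:
  assumes "0 < m"
  shows "m < nu (Suc (largest_exponent m))"
proof (rule ccontr)
  define k where "k = Suc (largest_exponent m)"
  assume "\<not> m < nu (Suc (largest_exponent m))"
  then have *: "1 \<le> k \<and> nu k \<le> m" by (simp add: k_def)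
  have "y \<le> m" if "1 \<le> y \<and> nu y \<le> m" for y
  proof -
    have "y < 2 ^ y" by (rule less_exp)
    moreover have "2 ^ y \<le> m + 1" using that by (auto simp: nu_def)
    ultimately show ?thesis by linarith
  qed
  from Greatest_le_nat[where P = "\<lambda>k. 1 \<le> k \<and> nu k \<le> m", OF * this]
  have "k \<le> largest_exponent m" by (simp add: largest_exponent_def)
  then show False by (simp add: k_def)
qed

lemma greedy_0 [simp]: "greedy 0 = {#}"
  by (simp add: greedy.simps)

text \<open>As \<open>nu (Suc k) = 2 * nu k + 1\<close>, the bound \<open>m \<le> nu k\<close> says
  exactly that \<open>k\<close> is the first greedy choice. Equality is allowed, and it is how a
  part comes to be repeated.\<close>

lemma greedy_add_nu:
  assumes "1 \<le> k" "m \<le> nu k"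
  shows "greedy (nu k + m) = add_mset k (greedy m)"
proof -
  have "largest_exponent (nu k + m) = k"
    using assms by (intro largest_exponent_eqI) (auto simp: nu_Suc)
  moreover have "nu k + m \<noteq> 0" using nu_pos[OF assms(1)] by simp
  ultimately show ?thesis by (subst greedy.simps) simp
qed

lemma greedy_nu: "1 \<le> k \<Longrightarrow> greedy (nu k) = {#k#}"
  using greedy_add_nu[of k 0] by simp

text \<open>The recursion in the form that drives the inductions below: the leading part is peeled
  off and the bound on the remainder is kept.\<close>

lemma greedy_decomp:
  assumes "0 < m"
  obtains k m' where "1 \<le> k" "m' \<le> nu k" "m = nu k + m'" "m' < m"
    "greedy m = add_mset k (greedy m')"
proof -
  define k where "k = largest_exponent m"
  have k: "1 \<le> k" "nu k \<le> m" "m < nu (Suc k)"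
    using largest_exponent[OF assms] less_nu_Suc_largest_exponent[OF assms] by (auto simp: k_def)
  have "m - nu k \<le> nu k" "m - nu k < m"
    using k nu_pos[OF k(1)] by (auto simp: nu_Suc)
  then show thesis
    using that[of k "m - nu k"] k greedy_add_nu[of k "m - nu k"] by simp
qed

lemma nu_mset_greedy [simp]: "nu_mset (greedy m) = m"
proof (induction m rule: less_induct)
  case (less m)
  show ?case
  proof (cases "m = 0")
    case False
    then show ?thesis using greedy_decomp[of m] less by (metis gr0I nu_mset_add)
  qed simp
qed

lemma greedy_pos: "i \<in># greedy m \<Longrightarrow> 1 \<le> i"
proof (induction m rule: less_induct)
  case (less m)
  then have "0 < m" by (cases "m = 0") auto
  then obtain k m' where "1 \<le> k" "m' < m" "greedy m = add_mset k (greedy m')"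
    using greedy_decomp by metis
  then show ?case using less by auto
qed

text \<open>A remainder equal to \<open>nu k\<close> is used up by a second copy of
  \<open>k\<close>, which ends the partition; a smaller remainder admits only parts below
  \<open>k\<close>. So a part can occur twice only at the very end, and never three times.\<close>

lemma greedy_count:
  assumes "2 \<le> count (greedy m) i"
  shows "count (greedy m) i = 2 \<and> (\<forall>j \<in># greedy m. i \<le> j)"
  using assms
proof (induction m rule: less_induct)
  case (less m)
  then have "0 < m" by (cases "m = 0") auto
  then obtain k m' where k: "1 \<le> k" "m' \<le> nu k" "m = nu k + m'" "m' < m"
    and g: "greedy m = add_mset k (greedy m')"
    using greedy_decomp by metis
  show ?case
  proof (cases "m' = nu k")
    case True
    then have "greedy m = {#k, k#}" using g greedy_nu[OF k(1)] by simp
    moreover from this have "i = k" using less.prems by (cases "i = k") auto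
    ultimately show ?thesis by simp
  next
    case False
    have lt: "j < k" if "j \<in># greedy m'" for j
    proof -
      have "nu j < nu k" using nu_le_nu_mset[OF that] False k(2) by simp
      then show ?thesis by (simp add: nu_less_iff)
    qed
    then have "k \<notin># greedy m'" by blast
    then have "i \<noteq> k" using less.prems g by (auto simp: not_in_iff)
    then have c: "count (greedy m) i = count (greedy m') i" using g by simp
    with less.IH[OF k(4)] less.prems
    have *: "count (greedy m') i = 2" "\<forall>j \<in># greedy m'. i \<le> j" by auto
    then have "i \<in># greedy m'" by (metis count_inI zero_neq_numeral)
    with * c lt g show ?thesis by (auto intro: less_imp_le)
  qed
qed

section \<open>Optimality of greedy partitions among ABPs\<close>

text \<open>The subtraction is passed on to the remainder until that is zero. Then
  \<open>m = nu (Suc l)\<close> and \<open>m - 1 = 2 * nu l\<close>, so one part is traded for two,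
  or for none when \<open>l = 0\<close>.\<close>

lemma size_greedy_minus_1: "size (greedy (m - 1)) \<le> size (greedy m) + 1"
proof (induction m rule: less_induct)
  case (less m)
  show ?case
  proof (cases "m = 0")
    case False
    then obtain k m' where k: "1 \<le> k" "m' \<le> nu k" "m = nu k + m'" "m' < m"
      and g: "greedy m = add_mset k (greedy m')"
      using greedy_decomp[of m] by (metis gr0I)
    show ?thesis
    proof (cases "m' = 0")
      case True
      obtain l where l: "k = Suc l" using k(1) by (cases k) auto
      have m: "m - 1 = nu l + nu l" using True k(3) l by (simp add: nu_Suc)
      show ?thesis
      proof (cases "l = 0")
        case False
        then have "greedy (m - 1) = {#l, l#}"
          using m greedy_add_nu[of l "nu l"] greedy_nu[of l] by simp
        then show ?thesis using g by simp
      qed (use m in simp)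
    next
      case False
      then have "greedy (m - 1) = add_mset k (greedy (m' - 1))"
        using k greedy_add_nu[of k "m' - 1"] by simp
      then show ?thesis using less.IH[OF k(4)] g by simp
    qed
  qed simp
qed

text \<open>The critical case is a carry: as \<open>2 * nu k = nu (Suc k) - 1\<close>, two copies of
  \<open>k\<close> merge into \<open>Suc k\<close> while the rest drops by one. The merger saves the
  part that the drop may cost by \<open>size_greedy_minus_1\<close>.\<close>

lemma size_greedy_add_nu:
  assumes "1 \<le> t"
  shows "size (greedy (m + nu t)) \<le> size (greedy m) + 1"
proof (induction m rule: less_induct)
  case (less m)
  show ?case
  proof (cases "m = 0")
    case True
    then show ?thesis using greedy_nu[OF assms] by simp
  next
    case False
    then obtain k m' where k: "1 \<le> k" "m' \<le> nu k" "m = nu k + m'" "m' < m"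
      and g: "greedy m = add_mset k (greedy m')"
      using greedy_decomp[of m] by (metis gr0I)
    consider "k < t" | "t = k" | "t < k" by linarith
    then show ?thesis
    proof cases
      case 1
      then have "nu (Suc k) \<le> nu t" by (intro nu_mono) simp
      then have "m \<le> nu t" using k by (simp add: nu_Suc)
      then have "greedy (m + nu t) = add_mset t (greedy m)"
        using greedy_add_nu[OF assms, of m] by (simp add: add.commute)
      then show ?thesis by simp
    next
      case 2
      show ?thesis
      proof (cases "m' = 0")
        case True
        then show ?thesis
          using 2 k greedy_add_nu[of k "nu k"] greedy_nu[of k] by simp
      next
        case False
        then have "m + nu t = nu (Suc k) + (m' - 1)" using 2 k by (simp add: nu_Suc)
        moreover have "m' - 1 \<le> nu (Suc k)" using k by (simp add: nu_Suc)
        ultimately have "greedy (m + nu t) = add_mset (Suc k) (greedy (m' - 1))"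
          using greedy_add_nu[of "Suc k" "m' - 1"] by simp
        then show ?thesis using size_greedy_minus_1[of m'] g by simp
      qed
    next
      case 3
      then have tk: "nu t < nu k" by (simp add: nu_less_iff)
      have IH: "size (greedy (m' + nu t)) \<le> size (greedy m') + 1"
        using less.IH[OF k(4)] .
      show ?thesis
      proof (cases "m' + nu t \<le> nu k")
        case True
        then have "greedy (m + nu t) = add_mset k (greedy (m' + nu t))"
          using k greedy_add_nu[of k "m' + nu t"] by (simp add: add.assoc)
        then show ?thesis using IH g by simp
      next
        case False
        \<comment> \<open>\<open>q\<close> is the overflow beyond \<open>nu k\<close>. The induction
          hypothesis for \<open>m' + nu t = nu k + q\<close> shows that \<open>greedy q\<close> has
          at most as many parts as \<open>greedy m'\<close>, which leaves room for the one part that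
          passing to \<open>q - 1\<close> may cost.\<close>
        define q where "q = m' + nu t - nu k"
        have q: "m' + nu t = nu k + q" "0 < q" "q \<le> nu k"
          using False k(2) tk by (auto simp: q_def)
        have "m + nu t = nu (Suc k) + (q - 1)" "q - 1 \<le> nu (Suc k)"
          using q k by (auto simp: nu_Suc)
        then have "greedy (m + nu t) = add_mset (Suc k) (greedy (q - 1))"
          using greedy_add_nu[of "Suc k" "q - 1"] by simp
        moreover have "greedy (m' + nu t) = add_mset k (greedy q)"
          using q k greedy_add_nu[of k q] by simp
        ultimately show ?thesis using size_greedy_minus_1[of q] IH g by simp
      qed
    qed
  qed
qed

text \<open>When \<open>M\<close> is built up part by part, each addition lengthens the greedy
  partition by at most one.\<close>

lemma size_greedy_le:
  assumes "\<forall>i \<in># M. 1 \<le> i"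
  shows "size (greedy (nu_mset M)) \<le> size M"
  using assms
proof (induction M)
  case (add t M)
  then show ?case using size_greedy_add_nu[of t "nu_mset M"] by (simp add: add.commute)
qed simp

text \<open>The leading part \<open>k\<close> of \<open>b\<close> satisfies
  \<open>b < nu (Suc k)\<close>, so a part of the smaller number \<open>a\<close> is at most
  \<open>k\<close>; disjointness excludes \<open>k\<close> itself.\<close>

lemma Max_mset_greedy_gt:
  assumes "a < b" "greedy a \<inter># greedy b = {#}" "i \<in># greedy a"
  shows "i < Max_mset (greedy b)"
proof -
  obtain k m where k: "b = nu k + m" "m \<le> nu k" "greedy b = add_mset k (greedy m)"
    using greedy_decomp[of b] assms(1) by (metis less_zeroE gr0I)
  have "nu i < nu (Suc k)"
    using nu_le_nu_mset[OF assms(3)] assms(1) k by (simp add: nu_Suc)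
  then have "i \<le> k" by (simp add: nu_less_iff)
  moreover have "i \<noteq> k"
    using assms(2,3) k(3) by (metis disjunct_not_in union_single_eq_member)
  moreover have "k \<le> Max_mset (greedy b)" using k(3) by simp
  ultimately show ?thesis by simp
qed

section \<open>Minimal SABPs\<close>

lemma tau_le: "sabp n P N \<Longrightarrow> tau n \<le> size P + size N"
  unfolding tau_def by (rule Least_le) blast

lemma minimal_sabp_exists: "\<exists>P N. minimal_sabp n P N"
proof -
  have "sabp n (greedy n) {#}" using greedy_pos by (auto simp: sabp_def)
  then have "\<exists>k P N. sabp n P N \<and> size P + size N = k" by blast
  then show ?thesis unfolding minimal_sabp_def tau_def by (rule LeastI_ex)
qed

text \<open>Cancelling a common part from both halves would save two parts.\<close>

lemma minimal_sabp_disjoint: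
  assumes "minimal_sabp n P N"
  shows "P \<inter># N = {#}"
proof (rule ccontr)
  assume "P \<inter># N \<noteq> {#}"
  then obtain i where "i \<in># P" "i \<in># N" by (meson disjunct_not_in)
  then obtain P' N' where P: "P = add_mset i P'" and N: "N = add_mset i N'"
    by (metis multi_member_split)
  have "sabp n P' N'" using assms by (auto simp: minimal_sabp_def sabp_def P N)
  from tau_le[OF this] assms show False by (simp add: minimal_sabp_def P N)
qed

text \<open>Replacing each half by its greedy partition keeps both sums and, by
  \<open>size_greedy_le\<close>, adds no parts.\<close>

lemma minimal_sabp_greedy_exists:
  "\<exists>P N. minimal_sabp n P N \<and> P = greedy (nu_mset P) \<and> N = greedy (nu_mset N)"
proof -
  obtain P N where min: "minimal_sabp n P N" using minimal_sabp_exists by blast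
  define P' where "P' = greedy (nu_mset P)"
  define N' where "N' = greedy (nu_mset N)"
  have pos: "\<forall>i \<in># P. 1 \<le> i" "\<forall>i \<in># N. 1 \<le> i"
    using min by (auto simp: minimal_sabp_def sabp_def)
  have s: "sabp n P' N'"
    using min greedy_pos by (auto simp: minimal_sabp_def sabp_def P'_def N'_def)
  have "size P' + size N' \<le> tau n"
    using min size_greedy_le[OF pos(1)] size_greedy_le[OF pos(2)]
    by (simp add: minimal_sabp_def P'_def N'_def)
  then have "minimal_sabp n P' N'" using s tau_le[OF s] by (simp add: minimal_sabp_def)
  moreover have "P' = greedy (nu_mset P')" "N' = greedy (nu_mset N')"
    by (simp_all add: P'_def N'_def)
  ultimately show ?thesis by blast
qed


section \<open>Boundaries\<close>

text \<open>Every edge is determined by its lower end, so the boundary edges of \<open>S\<close> are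
  recorded by their lower ends: \<open>up S\<close> collects those inside \<open>S\<close>,
  \<open>down S\<close> those outside.\<close>

definition up :: "vertex set \<Rightarrow> vertex set" where
  "up S = {v \<in> S. parent v \<notin> S}"

definition down :: "vertex set \<Rightarrow> vertex set" where
  "down S = {v \<in> verts - S. parent v \<in> S}"

lemma fst_parent [simp]: "fst (parent v) = Suc (fst v)"
  by (simp add: parent_def)

lemma verts_iff: "v \<in> verts \<longleftrightarrow> 1 \<le> fst v"
  by (cases v) (simp add: verts_def)

lemma parent_in_verts [simp]: "parent v \<in> verts"
  by (simp add: verts_iff)

lemma children_eq:
  "{v \<in> verts. parent v = s} = (if 2 \<le> fst s then {left_child s, right_child s} else {})"
proof -
  have "v \<in> verts \<and> parent v = s \<longleftrightarrow> 2 \<le> fst s \<and> (v = left_child s \<or> v = right_child s)" for v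
    by (cases v, cases s)
       (auto simp: verts_iff parent_def left_child_def right_child_def)
  then show ?thesis by auto
qed

lemma parent_left_child: "2 \<le> fst s \<Longrightarrow> parent (left_child s) = s"
  by (cases s) (simp add: parent_def left_child_def)

lemma parent_right_child: "2 \<le> fst s \<Longrightarrow> parent (right_child s) = s"
  by (cases s) (simp add: parent_def right_child_def)

lemma left_ne_right: "left_child s \<noteq> right_child s"
proof
  assume "left_child s = right_child s"
  then have "2 * snd s = 2 * snd s + 1" by (simp add: left_child_def right_child_def)
  then show False by simp
qed

text \<open>Leaves are no exception: they have no children in \<open>verts\<close>, and the
  right-hand side is \<open>2 * nu 0 = 0\<close>.\<close>

lemma sum_children_nu:
  "(\<Sum>v \<in> {v \<in> verts. parent v = s}. nu (fst v)) = 2 * nu (fst s - 1)"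
proof (cases "2 \<le> fst s")
  case True
  then show ?thesis unfolding children_eq using left_ne_right[of s]
    by (simp add: left_child_def right_child_def)
next
  case False
  then have "fst s - 1 = 0" by simp
  with False show ?thesis unfolding children_eq by simp
qed

lemma finite_children: "finite {v \<in> verts. parent v = s}"
  unfolding children_eq by simp

lemma finite_down:
  assumes "finite S"
  shows "finite (down S)"
proof (rule finite_subset)
  show "down S \<subseteq> (\<Union>s\<in>S. {v \<in> verts. parent v = s})" by (auto simp: down_def)
  show "finite (\<Union>s\<in>S. {v \<in> verts. parent v = s})"
    using assms finite_children by blast
qed

lemma card_eq_boundary_sum:
  assumes S: "S \<subseteq> verts" "finite S"
  shows "card S + (\<Sum>v \<in> down S. nu (fst v)) = (\<Sum>v \<in> up S. nu (fst v))"
proof -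
  let ?f = "\<lambda>v. nu (fst v)"
  \<comment> \<open>\<open>?I\<close> gives the lower ends of the edges inside \<open>S\<close>.
    Equation \<open>A\<close> splits the vertices of \<open>S\<close> by whether their parent is in
    \<open>S\<close>, equation \<open>B\<close> splits the children of \<open>S\<close> by whether
    they are in \<open>S\<close>; \<open>?I\<close> occurs in both and cancels.\<close>
  let ?I = "{v \<in> S. parent v \<in> S}"
  have fin: "finite (up S)" "finite ?I" using S by (auto simp: up_def)
  have "up S \<union> ?I = S" by (auto simp: up_def)
  moreover have "sum ?f (up S \<union> ?I) = sum ?f (up S) + sum ?f ?I"
    by (rule sum.union_disjoint[OF fin]) (auto simp: up_def)
  ultimately have A: "sum ?f S = sum ?f (up S) + sum ?f ?I" by simp
  have "down S \<union> ?I = (\<Union>s\<in>S. {v \<in> verts. parent v = s})"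
    using S by (auto simp: down_def)
  moreover have "sum ?f (down S \<union> ?I) = sum ?f (down S) + sum ?f ?I"
    by (rule sum.union_disjoint[OF finite_down[OF S(2)] fin(2)]) (auto simp: down_def)
  ultimately have "sum ?f (\<Union>s\<in>S. {v \<in> verts. parent v = s}) = sum ?f (down S) + sum ?f ?I"
    by simp
  moreover have "sum ?f (\<Union>s\<in>S. {v \<in> verts. parent v = s})
      = (\<Sum>s\<in>S. sum ?f {v \<in> verts. parent v = s})"
    by (rule sum.UNION_disjoint) (use S finite_children in auto)
  ultimately have B: "(\<Sum>s\<in>S. 2 * nu (fst s - 1)) = sum ?f (down S) + sum ?f ?I"
    by (simp add: sum_children_nu)
  have "nu (fst s) = 1 + 2 * nu (fst s - 1)" if "s \<in> S" for s
  proof -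
    have "fst s = Suc (fst s - 1)" using that S by (auto simp: verts_iff)
    then show ?thesis by (metis add.commute nu_Suc)
  qed
  then have "sum ?f S = (\<Sum>s\<in>S. 1 + 2 * nu (fst s - 1))" by (intro sum.cong) auto
  also have "\<dots> = card S + (\<Sum>s\<in>S. 2 * nu (fst s - 1))"
    by (simp only: sum.distrib card_eq_sum)
  finally show ?thesis using A B by simp
qed

lemma inj_parent_edge: "inj (\<lambda>v. {v, parent v})"
proof (rule injI)
  fix v w assume "{v, parent v} = {w, parent w}"
  then have "v = w \<or> (v = parent w \<and> w = parent v)" by (auto simp: doubleton_eq_iff)
  \<comment> \<open>Each passage to a parent raises the level, so two vertices cannot be parents of
    each other.\<close>
  moreover have "\<not> (v = parent w \<and> w = parent v)"
    by (metis fst_parent n_not_Suc_n Suc_n_not_le_n le_SucI order_refl)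
  ultimately show "v = w" by blast
qed

lemma edges_iff: "{u, w} \<in> edges \<longleftrightarrow> (u \<in> verts \<and> w = parent u) \<or> (w \<in> verts \<and> u = parent w)"
proof -
  have "{u, w} \<in> edges \<longleftrightarrow> (\<exists>v \<in> verts. {u, w} = {v, parent v})"
    unfolding edges_def by blast
  then show ?thesis by (auto simp: doubleton_eq_iff)
qed

lemma cut_eq:
  assumes "S \<subseteq> verts"
  shows "cut S = (\<lambda>v. {v, parent v}) ` (up S \<union> down S)"
proof (intro equalityI subsetI)
  fix e assume "e \<in> cut S"
  then obtain u w where "{u, w} \<in> edges" "u \<in> S" "w \<in> verts - S" "e = {u, w}"
    by (auto simp: cut_def)
  then show "e \<in> (\<lambda>v. {v, parent v}) ` (up S \<union> down S)"
    by (auto simp: edges_iff up_def down_def)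
next
  fix e assume "e \<in> (\<lambda>v. {v, parent v}) ` (up S \<union> down S)"
  then obtain v where e: "e = {v, parent v}" and v: "v \<in> up S \<or> v \<in> down S" by auto
  then have "v \<in> verts" using assms by (auto simp: up_def down_def)
  then have "e \<in> edges" using e by (simp add: edges_iff)
  moreover have "\<exists>u \<in> S. \<exists>w \<in> verts - S. e = {u, w}"
    using v
  proof
    assume "v \<in> up S"
    then show ?thesis
      using e by (intro bexI[of _ v] bexI[of _ "parent v"]) (auto simp: up_def)
  next
    assume "v \<in> down S"
    then show ?thesis
      using e by (intro bexI[of _ "parent v"] bexI[of _ v]) (auto simp: down_def)
  qed
  ultimately show "e \<in> cut S" by (simp add: cut_def)
qed

lemma card_cut:
  assumes "S \<subseteq> verts" "finite S"
  shows "card (cut S) = card (up S) + card (down S)"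
proof -
  have "card (cut S) = card (up S \<union> down S)"
    unfolding cut_eq[OF assms(1)]
    by (rule card_image) (rule inj_on_subset[OF inj_parent_edge], simp)
  also have "\<dots> = card (up S) + card (down S)"
    using assms finite_down[OF assms(2)]
    by (intro card_Un_disjoint) (auto simp: up_def down_def)
  finally show ?thesis .
qed

text \<open>The lower bound on cuts: the levels of \<open>up S\<close> and of \<open>down S\<close>
  are the two halves of an SABP of \<open>card S\<close> with one part per boundary edge.\<close>

lemma tau_le_card_cut:
  assumes "S \<subseteq> verts" "finite S"
  shows "tau (card S) \<le> card (cut S)"
proof -
  define P where "P = image_mset fst (mset_set (up S))"
  define N where "N = image_mset fst (mset_set (down S))"
  have fin: "finite (up S)" "finite (down S)"
    using assms finite_down by (auto simp: up_def)
  have "nu_mset P = (\<Sum>v \<in> up S. nu (fst v))" "nu_mset N = (\<Sum>v \<in> down S. nu (fst v))"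
    by (simp_all add: P_def N_def nu_mset_def sum_unfold_sum_mset multiset.map_comp comp_def)
  then have "int (card S) = int (nu_mset P) - int (nu_mset N)"
    using card_eq_boundary_sum[OF assms] by linarith
  moreover have "\<forall>i \<in># P. 1 \<le> i" "\<forall>i \<in># N. 1 \<le> i"
    using assms(1) fin by (auto simp: P_def N_def up_def down_def verts_iff)
  ultimately have "sabp (card S) P N" by (simp add: sabp_def)
  from tau_le[OF this] show ?thesis
    using card_cut[OF assms] by (simp add: P_def N_def)
qed


section \<open>Separated unions\<close>

lemma separated_sym: "separated A B \<Longrightarrow> separated B A"
  by (auto simp: separated_def insert_commute)

text \<open>No parent of a vertex in one set lies in the other, so \<open>up\<close> and
  \<open>down\<close> are additive. A vertex in both \<open>down A\<close> and \<open>down B\<close>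
  would have its parent in both sets.\<close>

lemma card_cut_Un:
  assumes "separated A B" "A \<subseteq> verts" "B \<subseteq> verts" "finite A" "finite B"
  shows "card (cut (A \<union> B)) = card (cut A) + card (cut B)"
proof -
  have "parent u \<notin> B" if "u \<in> A" for u
    using assms(1,2) that edges_iff[of u "parent u"] by (auto simp: separated_def)
  moreover have "parent u \<notin> A" if "u \<in> B" for u
    using assms(1,3) that edges_iff[of "parent u" u] by (auto simp: separated_def)
  ultimately have "up (A \<union> B) = up A \<union> up B" "down (A \<union> B) = down A \<union> down B"
    by (auto simp: up_def down_def)
  moreover have "up A \<inter> up B = {}"
    using assms(1) by (auto simp: up_def separated_def)
  moreover have "down A \<inter> down B = {}"
    using assms(1) by (auto simp: down_def separated_def)
  moreover have "finite (up A)" "finite (up B)" using assms by (auto simp: up_def)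
  ultimately show ?thesis
    using assms finite_down by (simp add: card_cut card_Un_disjoint)
qed

lemma separated_Union_right:
  assumes "\<And>T. T \<in> \<T> \<Longrightarrow> separated A T"
  shows "separated A (\<Union>\<T>)"
  using assms by (fastforce simp: separated_def)

lemma card_cut_Union:
  assumes "finite \<T>" "pairwise separated \<T>" "\<And>T. T \<in> \<T> \<Longrightarrow> T \<subseteq> verts \<and> finite T"
  shows "card (cut (\<Union>\<T>)) = (\<Sum>T\<in>\<T>. card (cut T))"
  using assms
proof (induction \<T>)
  case empty
  then show ?case by (simp add: cut_def)
next
  case (insert T \<T>)
  have "separated T (\<Union>\<T>)"
    using insert.prems(1) insert.hyps(2)
    by (intro separated_Union_right) (auto simp: pairwise_def)
  then have "card (cut (T \<union> \<Union>\<T>)) = card (cut T) + card (cut (\<Union>\<T>))"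
    using insert.prems(2) insert.hyps(1) by (intro card_cut_Un) auto
  moreover have "card (cut (\<Union>\<T>)) = (\<Sum>T\<in>\<T>. card (cut T))"
    using insert by (simp add: pairwise_insert)
  ultimately show ?case using insert.hyps by simp
qed

text \<open>Connectedness of \<open>T\<close> puts it inside the component of any of its vertices,
  and separation lets no edge leave \<open>T\<close> for another member.\<close>

lemma trees_of_Union:
  assumes "pairwise separated \<T>" "\<And>T. T \<in> \<T> \<Longrightarrow> is_subtree T"
  shows "trees_of (\<Union>\<T>) \<subseteq> \<T>"
proof
  fix X assume "X \<in> trees_of (\<Union>\<T>)"
  then obtain x T where T: "T \<in> \<T>" "x \<in> T" and X: "X = (induced_adj (\<Union>\<T>))\<^sup>* `` {x}"
    by (auto simp: trees_of_def quotient_def)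
  have "induced_adj T \<subseteq> induced_adj (\<Union>\<T>)" using T(1) by (auto simp: induced_adj_def)
  then have "T \<subseteq> X"
    using assms(2)[OF T(1)] T(2) rtrancl_mono unfolding X is_subtree_def by blast
  moreover have "y \<in> T" if "(x, y) \<in> (induced_adj (\<Union>\<T>))\<^sup>*" for y
    using that
  proof (induction rule: rtrancl_induct)
    case (step y z)
    then obtain T' where T': "T' \<in> \<T>" "z \<in> T'" and e: "{y, z} \<in> edges"
      by (auto simp: induced_adj_def)
    show ?case
    proof (cases "T' = T")
      case False
      then have "separated T T'" using assms(1) T(1) T'(1) by (auto simp: pairwise_def)
      then show ?thesis using e step.IH T'(2) by (auto simp: separated_def)
    qed (use T' in simp)
  qed (rule T)
  ultimately have "X = T" unfolding X by blast
  then show "X \<in> \<T>" using T(1) by simp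
qed


section \<open>Subtrees\<close>

lemma parent_funpow: "(parent ^^ k) (a, b) = (a + k, b div 2 ^ k)"
  by (induction k) (simp_all add: parent_def flip: div_mult2_eq mult.commute)

text \<open>The number of steps up is forced by the levels, which turns ancestry into arithmetic on
  indices.\<close>

lemma subtree_at_iff:
  "w \<in> subtree_at v \<longleftrightarrow> 1 \<le> fst w \<and> fst w \<le> fst v \<and> snd w div 2 ^ (fst v - fst w) = snd v"
proof -
  obtain a b where w: "w = (a, b)" by fastforce
  obtain i j where v: "v = (i, j)" by fastforce
  have "(\<exists>k. a + k = i \<and> b div 2 ^ k = j) \<longleftrightarrow> a \<le> i \<and> b div 2 ^ (i - a) = j"
    by (metis diff_add_inverse le_add1 le_add_diff_inverse)
  then show ?thesis by (auto simp: w v subtree_at_def verts_iff parent_funpow)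
qed

lemma subtree_at_refl: "v \<in> verts \<Longrightarrow> v \<in> subtree_at v"
  by (simp add: subtree_at_iff verts_iff)

lemma subtree_at_subset_verts: "subtree_at v \<subseteq> verts"
  by (auto simp: subtree_at_def)

lemma subtree_at_fst_le: "w \<in> subtree_at v \<Longrightarrow> fst w \<le> fst v"
  by (simp add: subtree_at_iff)

lemma subtree_at_descend:
  assumes "v \<in> verts" "parent v \<in> subtree_at s"
  shows "v \<in> subtree_at s"
proof -
  obtain k where "(parent ^^ k) (parent v) = s" using assms(2) by (auto simp: subtree_at_def)
  then have "(parent ^^ Suc k) v = s" by (simp add: funpow_swap1)
  then show ?thesis using assms(1) unfolding subtree_at_def by blast
qed

lemma subtree_at_ascend:
  assumes "v \<in> subtree_at s" "v \<noteq> s"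
  shows "parent v \<in> subtree_at s"
proof -
  obtain k where k: "(parent ^^ k) v = s" using assms(1) by (auto simp: subtree_at_def)
  with assms(2) obtain l where "k = Suc l" by (cases k) auto
  with k have "(parent ^^ l) (parent v) = s" by (simp add: funpow_swap1)
  then show ?thesis unfolding subtree_at_def by auto
qed

lemma subtree_at_inj:
  assumes "w \<in> subtree_at u" "w \<in> subtree_at v" "fst u = fst v"
  shows "u = v"
  using assms by (auto simp: subtree_at_iff prod_eq_iff)

lemma finite_subtree_at: "finite (subtree_at v)"
proof (rule finite_subset)
  show "subtree_at v \<subseteq> {..fst v} \<times> {..<Suc (snd v) * 2 ^ fst v}"
  proof
    fix w assume w: "w \<in> subtree_at v"
    \<comment> \<open>At depth \<open>?d\<close> below \<open>v\<close> all indices are less than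
      \<open>Suc (snd v) * 2 ^ ?d\<close>; the depth is at most \<open>fst v\<close>, which gives
      one bound for all levels.\<close>
    let ?d = "fst v - fst w"
    have "snd w < Suc (snd w div 2 ^ ?d) * 2 ^ ?d"
      by (metis dividend_less_div_times add.commute mult_Suc zero_less_numeral zero_less_power)
    also have "\<dots> \<le> Suc (snd v) * 2 ^ fst v"
      using w by (intro mult_mono) (auto simp: subtree_at_iff)
    finally show "w \<in> {..fst v} \<times> {..<Suc (snd v) * 2 ^ fst v}"
      using w by (auto simp: subtree_at_iff mem_Times_iff)
  qed
qed simp

lemma up_subtree_at:
  assumes "v \<in> verts"
  shows "up (subtree_at v) = {v}"
proof -
  have "parent v \<notin> subtree_at v" using subtree_at_fst_le[of "parent v" v] by auto
  then show ?thesis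
    using subtree_at_ascend subtree_at_refl[OF assms] unfolding up_def by blast
qed

lemma down_subtree_at: "down (subtree_at v) = {}"
  using subtree_at_descend unfolding down_def by blast

text \<open>Climbing from \<open>v\<close> towards its ancestor \<open>r\<close> never leaves
  \<open>S\<close>, since only \<open>r\<close> may have its parent outside. The climb can be
  reversed because edges are undirected.\<close>

lemma connected_to_root:
  assumes "S \<subseteq> subtree_at r" "up S \<subseteq> {r}" "v \<in> S"
  shows "(v, r) \<in> (induced_adj S)\<^sup>* \<and> (r, v) \<in> (induced_adj S)\<^sup>*"
proof -
  obtain k where "(parent ^^ k) v = r" using assms by (auto simp: subtree_at_def)
  then show ?thesis using assms(3)
  proof (induction k arbitrary: v)
    case (Suc k)
    show ?case
    proof (cases "v = r")
      case False
      then have p: "parent v \<in> S" using assms(2) Suc.prems by (auto simp: up_def)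
      have "v \<in> verts" using Suc.prems assms(1) subtree_at_subset_verts by blast
      then have "(v, parent v) \<in> induced_adj S" "(parent v, v) \<in> induced_adj S"
        using p Suc.prems by (auto simp: induced_adj_def edges_iff)
      moreover have "(parent ^^ k) (parent v) = r" using Suc.prems by (simp add: funpow_swap1)
      then have "(parent v, r) \<in> (induced_adj S)\<^sup>* \<and> (r, parent v) \<in> (induced_adj S)\<^sup>*"
        using Suc.IH p by blast
      ultimately show ?thesis
        by (meson converse_rtrancl_into_rtrancl rtrancl.rtrancl_into_rtrancl)
    qed simp
  qed simp
qed

lemma is_subtreeI:
  assumes "S \<subseteq> subtree_at r" "up S = {r}"
  shows "is_subtree S"
  unfolding is_subtree_def
proof (intro conjI ballI)
  show "S \<subseteq> verts" using assms(1) subtree_at_subset_verts by blast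
  show "finite S" using assms(1) finite_subtree_at finite_subset by blast
  show "S \<noteq> {}" using assms(2) by (auto simp: up_def)
  fix u w assume "u \<in> S" "w \<in> S"
  then have "(u, r) \<in> (induced_adj S)\<^sup>*" "(r, w) \<in> (induced_adj S)\<^sup>*"
    using connected_to_root[OF assms(1) equalityD1[OF assms(2)]] by blast+
  then show "(u, w) \<in> (induced_adj S)\<^sup>*" by (rule rtrancl_trans)
qed

lemma subtree_at_children:
  assumes "w \<in> subtree_at v" "2 \<le> fst w"
  shows "left_child w \<in> subtree_at v" "right_child w \<in> subtree_at v"
  using assms subtree_at_descend parent_left_child parent_right_child
  by (auto simp: verts_iff left_child_def right_child_def)

lemma leaf_children_not_verts:
  assumes "fst w = 1"
  shows "left_child w \<notin> verts" "right_child w \<notin> verts"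
  using assms by (simp_all add: verts_iff left_child_def right_child_def)

lemma fst_leaves_subtree_at:
  assumes "w \<in> leaves (subtree_at v)"
  shows "fst w = 1"
proof (rule ccontr)
  assume "fst w \<noteq> 1"
  moreover have w: "w \<in> subtree_at v" "left_child w \<notin> subtree_at v"
    using assms by (auto simp: leaves_def)
  ultimately have "2 \<le> fst w" by (auto simp: subtree_at_iff)
  then show False using subtree_at_children[OF w(1)] w(2) by simp
qed

lemma complete_subtree_at:
  assumes "v \<in> verts"
  shows "complete_binary_tree (subtree_at v)"
  unfolding complete_binary_tree_def
proof (intro conjI ballI)
  show "is_subtree (subtree_at v)" using up_subtree_at[OF assms] by (intro is_subtreeI) auto
next
  fix w assume w: "w \<in> subtree_at v"
  show "left_child w \<in> subtree_at v \<longleftrightarrow> right_child w \<in> subtree_at v"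
  proof (cases "2 \<le> fst w")
    case True
    then show ?thesis using subtree_at_children[OF w] by simp
  next
    case False
    then have "fst w = 1" using w by (simp add: subtree_at_iff)
    then show ?thesis using leaf_children_not_verts subtree_at_subset_verts by blast
  qed
qed (simp add: fst_leaves_subtree_at)

text \<open>In the boundary identity only the term of the edge above \<open>v\<close>
  survives.\<close>

lemma card_subtree_at:
  assumes "v \<in> verts"
  shows "card (subtree_at v) = nu (fst v)"
  using card_eq_boundary_sum[OF subtree_at_subset_verts finite_subtree_at, of v]
    up_subtree_at[OF assms] down_subtree_at by simp

text \<open>Needed because \<open>p_forest\<close> describes its trees by properties and not as
  \<open>subtree_at\<close>. With all leaves at level 1 there is no boundary edge below
  \<open>T\<close>; each edge above weighs \<open>nu t\<close>, and the total weight is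
  \<open>card T = nu t\<close>, so there is just one.\<close>

lemma complete_tree_card_cut:
  assumes T: "complete_binary_tree T" "\<And>v. v \<in> leaves T \<Longrightarrow> fst v = 1"
    and root: "\<And>v. is_root T v \<Longrightarrow> fst v = t" and card: "card T = nu t"
  shows "card (cut T) = 1"
proof -
  have sub: "T \<subseteq> verts" "finite T" "T \<noteq> {}"
    using T(1) by (auto simp: complete_binary_tree_def is_subtree_def)
  have "down T = {}"
  proof (rule ccontr)
    assume "down T \<noteq> {}"
    then obtain v where v: "v \<in> verts" "v \<notin> T" "parent v \<in> T" by (auto simp: down_def)
    then have "parent v \<notin> leaves T" using T(2)[of "parent v"] by (auto simp: verts_iff)
    then have "left_child (parent v) \<in> T" "right_child (parent v) \<in> T"
      using v T(1) by (auto simp: leaves_def complete_binary_tree_def)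
    moreover have "v \<in> {left_child (parent v), right_child (parent v)}"
      using children_eq[of "parent v"] v(1) by (metis (mono_tags) empty_iff mem_Collect_eq)
    ultimately show False using v by auto
  qed
  moreover have "(\<Sum>v \<in> up T. nu (fst v)) = card (up T) * nu t"
    using root by (simp add: up_def is_root_def)
  ultimately have "nu t = card (up T) * nu t"
    using card_eq_boundary_sum[OF sub(1,2)] card by simp
  moreover have "0 < nu t" using card sub by (metis card_gt_0_iff)
  ultimately have "card (up T) = 1" by simp
  then show ?thesis using card_cut[OF sub(1,2)] \<open>down T = {}\<close> by simp
qed


section \<open>The C-tree\<close>

text \<open>\<open>m\<close> is the horizontal position of the root. \<open>N_less\<close> puts all
  parts of \<open>N\<close> strictly below the root level, and \<open>N_greedy\<close> confines
  repetition to the smallest part, with multiplicity two.\<close>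

locale c_tree_setup =
  fixes r m :: nat and N :: "nat multiset"
  assumes r_pos: "1 \<le> r"
    and N_less: "\<And>i. i \<in># N \<Longrightarrow> i < r"
    and N_greedy: "N = greedy (nu_mset N)"
begin

definition h where "h = c_bottom N"

text \<open>The path reindexed by level: \<open>c_path\<close> counts steps from the root, whereas
  \<open>p j\<close> sits at level \<open>j\<close> when \<open>j \<le> r\<close>.\<close>

definition p where "p j = c_path N (r, m) (r - j)"

lemma N_pos: "i \<in># N \<Longrightarrow> 1 \<le> i"
  using greedy_pos N_greedy by metis

lemma repeated:
  assumes "h \<noteq> 1"
  obtains t where "h = Suc t" "1 \<le> t" "count N t = 2" "\<And>i. i \<noteq> t \<Longrightarrow> count N i \<le> 1"
    "\<And>i. i \<in># N \<Longrightarrow> t \<le> i"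
proof -
  obtain t where "\<not> count N t \<le> 1"
    using assms unfolding h_def c_bottom_def by meson
  then have rep: "2 \<le> count N t" by simp
  have t: "count N i = 2 \<and> (\<forall>j \<in># N. i \<le> j)" if "2 \<le> count N i" for i
    using that greedy_count N_greedy by metis
  have "t \<in># N" using rep by (metis count_inI not_numeral_le_zero)
  then have "Min_mset N = t" using t[OF rep] by (intro Min_eqI) auto
  then have "h = Suc t" using rep assms by (auto simp: h_def c_bottom_def split: if_splits)
  moreover have "count N i \<le> 1" if "i \<noteq> t" for i
  proof (rule ccontr)
    assume "\<not> count N i \<le> 1"
    then have i: "2 \<le> count N i" by simp
    then have "i \<in># N" by (metis count_inI not_numeral_le_zero)
    then show False using t[OF i] t[OF rep] \<open>t \<in># N\<close> that by (meson antisym)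
  qed
  ultimately show thesis using that[of t] t[OF rep] N_pos[OF \<open>t \<in># N\<close>] by blast
qed

lemma h_bounds: "1 \<le> h" "h \<le> r"
proof -
  show "1 \<le> h" by (auto simp: h_def c_bottom_def)
  show "h \<le> r"
  proof (cases "h = 1")
    case False
    then obtain t where "h = Suc t" "count N t = 2" using repeated by metis
    then show ?thesis using N_less[of t] by (metis Suc_leI count_inI zero_neq_numeral)
  qed (use r_pos in simp)
qed

text \<open>Matches \<open>N\<close> with the two kinds of deleted subtrees: each part from
  \<open>h\<close> upwards belongs to one left turn of the path, and the doubled part
  \<open>h - 1\<close> to the two children of the bottom vertex.\<close>

lemma N_decomp:
  "N = mset_set {i. i \<in># N \<and> h \<le> i} + (if h = 1 then {#} else {#h - 1, h - 1#})"
proof (rule multiset_eqI)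
  fix i
  have fin: "finite {i. i \<in># N \<and> h \<le> i}" by (rule finite_subset[of _ "set_mset N"]) auto
  show "count N i = count (mset_set {i. i \<in># N \<and> h \<le> i}
      + (if h = 1 then {#} else {#h - 1, h - 1#})) i"
  proof (cases "h = 1")
    case True
    \<comment> \<open>A repetition would give \<open>h = Min_mset N + 1\<close>, which is at least
      2.\<close>
    have "\<forall>i. count N i \<le> 1"
    proof (rule ccontr)
      assume rep: "\<not> (\<forall>i. count N i \<le> 1)"
      then have "N \<noteq> {#}" by auto
      then have "1 \<le> Min_mset N" using N_pos by simp
      moreover have "h = Min_mset N + 1" using rep unfolding h_def c_bottom_def by meson
      ultimately show False using True by simp
    qed
    then have "count N i = (if i \<in># N then 1 else 0)"
      by (metis count_eq_zero_iff count_greater_eq_one_iff antisym)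
    moreover have "{i. i \<in># N \<and> h \<le> i} = set_mset N" using True N_pos by auto
    ultimately show ?thesis using True by (simp add: count_mset_set')
  next
    case False
    then obtain t where t: "h = Suc t" "count N t = 2" "\<And>i. i \<noteq> t \<Longrightarrow> count N i \<le> 1"
      "\<And>i. i \<in># N \<Longrightarrow> t \<le> i" using repeated by metis
    show ?thesis
    proof (cases "i = t")
      case True
      then show ?thesis using t False fin by (simp add: count_mset_set')
    next
      case i: False
      then have "count N i = (if i \<in># N then 1 else 0)"
        using t(3) by (metis count_eq_zero_iff count_greater_eq_one_iff antisym)
      moreover have "i \<in># N \<longleftrightarrow> i \<in># N \<and> Suc t \<le> i" using t(4) i by fastforce
      ultimately show ?thesis using t(1) i fin by (simp add: count_mset_set')
    qed
  qed
qed

lemma p_r [simp]: "p r = (r, m)"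
  by (simp add: p_def)

lemma fst_c_path: "fst (c_path N (r, m) k) = r - k"
  by (induction k) (auto simp: left_child_def right_child_def)

lemma fst_p: "j \<le> r \<Longrightarrow> fst (p j) = j"
  by (simp add: p_def fst_c_path)

lemma p_step:
  assumes "j < r"
  shows "p j = (if j \<in># N then left_child (p (Suc j)) else right_child (p (Suc j)))"
proof -
  have "r - j = Suc (r - Suc j)" using assms by simp
  then show ?thesis using assms by (simp add: p_def fst_c_path)
qed

lemma p_left_iff: "j < r \<Longrightarrow> p j = left_child (p (Suc j)) \<longleftrightarrow> j \<in># N"
  using p_step left_ne_right by metis

lemma parent_p: "1 \<le> j \<Longrightarrow> j < r \<Longrightarrow> parent (p j) = p (Suc j)"
  using p_step[of j] fst_p[of "Suc j"] parent_left_child parent_right_child by auto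

lemma p_in_verts: "1 \<le> j \<Longrightarrow> j \<le> r \<Longrightarrow> p j \<in> verts"
  by (simp add: verts_iff fst_p)

lemma p_in_subtree:
  assumes "1 \<le> i" "i \<le> j" "j \<le> r"
  shows "p i \<in> subtree_at (p j)"
  using assms(2,1,3)
proof (induction rule: inc_induct)
  case base
  then show ?case using p_in_verts subtree_at_refl by simp
next
  case (step i)
  then show ?case
    using subtree_at_descend[of "p i" "p j"] p_in_verts[of i] parent_p[of i] by simp
qed

section \<open>The boundary of the C-tree\<close>

text \<open>The roots of the deleted subtrees. Those beside the path are indexed by their own level
  \<open>i\<close>, one less than the level of the turning vertex, so that \<open>i\<close> is
  itself the part of \<open>N\<close>.\<close>

definition removed where
  "removed = (\<lambda>i. right_child (p (Suc i))) ` {i. i \<in># N \<and> h \<le> i}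
     \<union> (if h = 1 then {} else {left_child (p h), right_child (p h)})"

lemma c_tree_eq: "c_tree r N m = subtree_at (r, m) - (\<Union>v \<in> removed. subtree_at v)"
proof -
  let ?J = "{j. h + 1 \<le> j \<and> j \<le> r \<and> p (j - 1) = left_child (p j)}"
  \<comment> \<open>The path turns left from level \<open>j\<close> exactly when
    \<open>j - 1\<close> is in \<open>N\<close>.\<close>
  have "?J = Suc ` {i. i \<in># N \<and> h \<le> i}"
  proof (intro equalityI subsetI)
    fix j assume j: "j \<in> ?J"
    then have "j = Suc (j - 1)" "j - 1 < r" by auto
    then have "j - 1 \<in># N" using j p_left_iff[of "j - 1"] by auto
    then show "j \<in> Suc ` {i. i \<in># N \<and> h \<le> i}" using j by (intro image_eqI[of _ _ "j - 1"]) auto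
  next
    fix j assume "j \<in> Suc ` {i. i \<in># N \<and> h \<le> i}"
    then show "j \<in> ?J" using p_left_iff N_less by (auto simp: Suc_le_eq)
  qed
  moreover have "c_tree r N m = subtree_at (r, m)
      - (\<Union>j \<in> ?J. subtree_at (right_child (p j)))
      - (if h \<noteq> 1 then subtree_at (left_child (p h)) \<union> subtree_at (right_child (p h)) else {})"
    by (simp add: c_tree_def Let_def h_def[symmetric] p_def[symmetric])
  ultimately show ?thesis by (auto simp: removed_def)
qed

lemma removed_cases:
  assumes "v \<in> removed"
  obtains (branch) i where "i \<in># N" "h \<le> i" "i < r" "v = right_child (p (Suc i))"
  | (bottom) "h \<noteq> 1" "v = left_child (p h) \<or> v = right_child (p h)"
  using assms N_less by (auto simp: removed_def split: if_splits)

lemma removed_parent: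
  assumes "v \<in> removed"
  shows "v \<in> verts \<and> (\<exists>j. h \<le> j \<and> j \<le> r \<and> parent v = p j)"
  using assms
proof (cases rule: removed_cases)
  case (branch i)
  then have "2 \<le> fst (p (Suc i))" using h_bounds fst_p[of "Suc i"] by simp
  then show ?thesis using branch parent_right_child
    by (auto simp: verts_iff right_child_def intro!: exI[of _ "Suc i"])
next
  case bottom
  then have "2 \<le> fst (p h)" using h_bounds fst_p[of h] by simp
  then show ?thesis using bottom h_bounds parent_right_child parent_left_child
    by (auto simp: verts_iff right_child_def left_child_def intro!: exI[of _ h])
qed

text \<open>Beside a left turn the path runs through the left sibling of \<open>v\<close>, and
  distinct vertices of one level share no descendants. At the bottom, \<open>v\<close> has level
  \<open>h - 1\<close>, below every \<open>p j\<close> considered.\<close>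

lemma p_not_removed:
  assumes "h \<le> j" "j \<le> r" "v \<in> removed"
  shows "p j \<notin> subtree_at v"
proof
  assume pv: "p j \<in> subtree_at v"
  from assms(3) show False
  proof (cases rule: removed_cases)
    case (branch i)
    have fv: "fst v = i" using branch fst_p[of "Suc i"] by (simp add: right_child_def)
    have "j \<le> i" using subtree_at_fst_le[OF pv] fv fst_p assms by simp
    then have "p j \<in> subtree_at (p i)"
      using p_in_subtree[of j i] branch h_bounds assms(1) by simp
    then have "p i = v" using subtree_at_inj[OF _ pv] fv fst_p branch by simp
    moreover have "p i = left_child (p (Suc i))" using p_left_iff branch by simp
    ultimately show False using branch left_ne_right by metis
  next
    case bottom
    then have "fst v = h - 1" using fst_p h_bounds by (auto simp: left_child_def right_child_def)
    then show False using subtree_at_fst_le[OF pv] fst_p assms h_bounds by simp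
  qed
qed

lemma p_in_c_tree: "h \<le> j \<Longrightarrow> j \<le> r \<Longrightarrow> p j \<in> c_tree r N m"
  using p_in_subtree[of j r] p_not_removed h_bounds unfolding c_tree_eq by auto

lemma c_tree_subset: "c_tree r N m \<subseteq> subtree_at (r, m)"
  by (auto simp: c_tree_eq)

text \<open>The deleted sets are closed under descendants, so the parent of a surviving vertex
  survives unless that vertex is the root.\<close>

lemma up_c_tree: "up (c_tree r N m) = {(r, m)}"
proof -
  have "v = (r, m)" if v: "v \<in> c_tree r N m" "parent v \<notin> c_tree r N m" for v
  proof (rule ccontr)
    assume "v \<noteq> (r, m)"
    then have "parent v \<in> subtree_at (r, m)" using v subtree_at_ascend by (simp add: c_tree_eq)
    then obtain w where "w \<in> removed" "parent v \<in> subtree_at w"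
      using v(2) unfolding c_tree_eq by blast
    moreover have "v \<in> verts" using v subtree_at_subset_verts unfolding c_tree_eq by blast
    ultimately show False using v(1) subtree_at_descend unfolding c_tree_eq by blast
  qed
  moreover have "(r, m) \<in> c_tree r N m" using p_in_c_tree[of r] h_bounds by simp
  moreover have "parent (r, m) \<notin> c_tree r N m"
    using subtree_at_fst_le[of "parent (r, m)" "(r, m)"] c_tree_subset by fastforce
  ultimately show ?thesis unfolding up_def by blast
qed

text \<open>A missing vertex with a surviving parent must be the top of a deleted subtree;
  conversely each such top hangs from a path vertex, and those survive.\<close>

lemma down_c_tree: "down (c_tree r N m) = removed"
proof (intro equalityI subsetI)
  fix v assume v: "v \<in> down (c_tree r N m)"
  then have "v \<in> subtree_at (r, m)"
    using subtree_at_descend unfolding down_def c_tree_eq by blast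
  then obtain w where w: "w \<in> removed" "v \<in> subtree_at w"
    using v unfolding down_def c_tree_eq by blast
  moreover have "parent v \<notin> subtree_at w" using v w unfolding down_def c_tree_eq by blast
  ultimately show "v \<in> removed" using subtree_at_ascend by metis
next
  fix v assume v: "v \<in> removed"
  then have "v \<in> verts" "parent v \<in> c_tree r N m"
    using removed_parent[OF v] p_in_c_tree by auto
  moreover have "v \<notin> c_tree r N m"
    using v \<open>v \<in> verts\<close> subtree_at_refl unfolding c_tree_eq by blast
  ultimately show "v \<in> down (c_tree r N m)" by (simp add: down_def)
qed

text \<open>The roots beside the path have distinct levels, all at least \<open>h\<close>, while the
  children of the bottom vertex are both at level \<open>h - 1\<close>; this is the splitting of
  \<open>N_decomp\<close>.\<close>

lemma image_fst_removed: "image_mset fst (mset_set removed) = N"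
proof -
  let ?f = "\<lambda>i. right_child (p (Suc i))"
  let ?A = "{i. i \<in># N \<and> h \<le> i}"
  let ?B = "if h = 1 then {} else {left_child (p h), right_child (p h)}"
  have fin: "finite ?A" by (rule finite_subset[of _ "set_mset N"]) auto
  have fst_f: "fst (?f i) = i" if "i \<in> ?A" for i
    using that fst_p[of "Suc i"] N_less[of i] by (simp add: right_child_def)
  have fst_B: "fst v = h - 1" if "v \<in> ?B" for v
    using that fst_p h_bounds by (auto simp: left_child_def right_child_def split: if_splits)
  have "?f ` ?A \<inter> ?B = {}"
  proof -
    have False if "i \<in> ?A" "?f i \<in> ?B" for i
    proof -
      have "i = h - 1" using fst_f[OF that(1)] fst_B[OF that(2)] by simp
      then show False using that(1) h_bounds(1) by fastforce
    qed
    then show ?thesis by blast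
  qed
  then have "mset_set removed = mset_set (?f ` ?A) + mset_set ?B"
    unfolding removed_def using fin by (intro mset_set_Union) auto
  moreover have "image_mset fst (mset_set (?f ` ?A)) = mset_set ?A"
  proof -
    have "inj_on ?f ?A" using fst_f by (metis (no_types, lifting) inj_onI)
    then have "mset_set (?f ` ?A) = image_mset ?f (mset_set ?A)"
      by (simp add: image_mset_mset_set)
    then have "image_mset fst (mset_set (?f ` ?A)) = image_mset (\<lambda>i. fst (?f i)) (mset_set ?A)"
      by (simp add: multiset.map_comp comp_def)
    also have "\<dots> = image_mset (\<lambda>i. i) (mset_set ?A)"
      using fin fst_f by (intro image_mset_cong) auto
    finally show ?thesis by simp
  qed
  moreover have "image_mset fst (mset_set ?B) = (if h = 1 then {#} else {#h - 1, h - 1#})"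
    using left_ne_right[of "p h"] fst_B by (cases "h = 1") auto
  ultimately show ?thesis using N_decomp by simp
qed

lemma finite_c_tree: "finite (c_tree r N m)"
  using c_tree_subset finite_subtree_at finite_subset by blast

lemma c_tree_subset_verts: "c_tree r N m \<subseteq> verts"
  using c_tree_subset subtree_at_subset_verts by blast

text \<open>In the boundary identity the root contributes \<open>nu r\<close> and the deleted
  subtrees contribute \<open>nu_mset N\<close>.\<close>

lemma card_c_tree: "card (c_tree r N m) + nu_mset N = nu r"
proof -
  have "nu_mset N = (\<Sum>v \<in> removed. nu (fst v))"
    by (subst image_fst_removed[symmetric])
       (simp add: nu_mset_def sum_unfold_sum_mset multiset.map_comp comp_def)
  then show ?thesis
    using card_eq_boundary_sum[OF c_tree_subset_verts finite_c_tree] up_c_tree down_c_tree by simp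
qed

lemma card_cut_c_tree: "card (cut (c_tree r N m)) = 1 + size N"
proof -
  have "size N = card removed"
    by (subst image_fst_removed[symmetric]) simp
  then show ?thesis
    using card_cut[OF c_tree_subset_verts finite_c_tree] up_c_tree down_c_tree by simp
qed

lemma is_subtree_c_tree: "is_subtree (c_tree r N m)"
  using is_subtreeI[OF c_tree_subset up_c_tree] .

end


section \<open>Placing the forest\<close>

text \<open>The index of the ancestor of \<open>v\<close> at level \<open>L\<close>. Sets below level \<open>L\<close> whose vertices lie under
  different vertices of level \<open>L\<close> are separated.\<close>

definition block :: "nat \<Rightarrow> vertex \<Rightarrow> nat" where
  "block L v = snd v div 2 ^ (L - fst v)"

lemma block_parent:
  assumes "fst v < L"
  shows "block L (parent v) = block L v"
proof -
  have "L - fst v = Suc (L - Suc (fst v))" using assms by simp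
  then show ?thesis by (simp add: block_def parent_def div_mult2_eq)
qed

lemma separated_blocks:
  assumes "\<And>v. v \<in> A \<union> B \<Longrightarrow> fst v < L"
    and "\<And>u w. u \<in> A \<Longrightarrow> w \<in> B \<Longrightarrow> block L u \<noteq> block L w"
  shows "separated A B"
  unfolding separated_def
proof (intro conjI ballI)
  show "A \<inter> B = {}" using assms(2) by blast
  fix u w assume "u \<in> A" "w \<in> B"
  then show "{u, w} \<notin> edges"
    using assms(2)[of u w] assms(1)[of u] assms(1)[of w] block_parent[of u L] block_parent[of w L]
    by (auto simp: edges_iff)
qed

text \<open>The vertex \<open>(t, k * 2 ^ (L - t))\<close> is the leftmost descendant of
  \<open>(L, k)\<close> at level \<open>t\<close>.\<close>

lemma block_subtree_at:
  assumes "w \<in> subtree_at (t, k * 2 ^ (L - t))" "t \<le> L"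
  shows "block L w = k"
proof -
  have w: "fst w \<le> t" "snd w div 2 ^ (t - fst w) = k * 2 ^ (L - t)"
    using assms(1) by (auto simp: subtree_at_iff)
  have "L - fst w = (t - fst w) + (L - t)" using w(1) assms(2) by simp
  then have "block L w = snd w div 2 ^ (t - fst w) div 2 ^ (L - t)"
    by (simp add: block_def power_add div_mult2_eq)
  then show ?thesis using w(2) by simp
qed

text \<open>Each tree gets a block of its own, numbered from 1 to \<open>size P\<close>; block 0 is
  kept free for the C-tree.\<close>

lemma p_forest_exists:
  assumes "\<forall>i \<in># P. 1 \<le> i \<and> i < L"
  shows "\<exists>F. p_forest P F \<and> (\<forall>v \<in> F. fst v < L \<and> 1 \<le> block L v \<and> block L v \<le> size P)"
  using assms
proof (induction P)
  case empty
  have "p_forest {#} {}" unfolding p_forest_def by (intro exI[of _ "{}"]) simp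
  then show ?case by blast
next
  case (add x P)
  then obtain F where F: "p_forest P F"
    "\<forall>v \<in> F. fst v < L \<and> 1 \<le> block L v \<and> block L v \<le> size P" by auto
  obtain \<T> t where \<T>: "finite \<T>" "F = \<Union>\<T>" "pairwise separated \<T>"
    "image_mset t (mset_set \<T>) = P"
    "\<forall>T \<in> \<T>. complete_binary_tree T \<and> card T = 2 ^ t T - 1
          \<and> (\<forall>v. is_root T v \<longrightarrow> fst v = t T) \<and> (\<forall>v \<in> leaves T. fst v = 1)"
    using F(1) unfolding p_forest_def by auto
  have x: "1 \<le> x" "x < L" using add.prems by auto
  define v where "v = (x, Suc (size P) * 2 ^ (L - x))"
  define T where "T = subtree_at v"
  have v: "v \<in> verts" using x by (simp add: v_def verts_iff)
  have T: "fst w < L" "block L w = Suc (size P)" if "w \<in> T" for w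
  proof -
    show "fst w < L" using that subtree_at_fst_le[of w v] x by (simp add: T_def v_def)
    show "block L w = Suc (size P)" using that block_subtree_at x by (simp add: T_def v_def)
  qed
  have sep: "separated T T'" if "T' \<in> \<T>" for T'
  proof (rule separated_blocks)
    show "fst w < L" if "w \<in> T \<union> T'" for w
      using that T F(2) \<T>(2) \<open>T' \<in> \<T>\<close> by blast
    show "block L u \<noteq> block L w" if "u \<in> T" "w \<in> T'" for u w
    proof -
      have "w \<in> F" using that(2) \<open>T' \<in> \<T>\<close> \<T>(2) by blast
      then have "block L w \<le> size P" using F(2) by blast
      then show ?thesis using T(2)[OF that(1)] by simp
    qed
  qed
  have "v \<in> T" using v subtree_at_refl by (simp add: T_def)
  \<comment> \<open>\<open>T\<close> is nonempty, hence not separated from itself.\<close>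
  then have notin: "T \<notin> \<T>" using sep unfolding separated_def by blast
  define t' where "t' = t(T := x)"
  have "image_mset t' (mset_set \<T>) = image_mset t (mset_set \<T>)"
    using notin \<T>(1) by (intro image_mset_cong) (auto simp: t'_def)
  then have "image_mset t' (mset_set (insert T \<T>)) = add_mset x P"
    using \<T>(1,4) notin by (simp add: t'_def)
  moreover have "pairwise separated (insert T \<T>)"
    using \<T>(3) sep separated_sym by (auto simp: pairwise_insert)
  moreover have "complete_binary_tree T \<and> card T = 2 ^ t' T - 1
          \<and> (\<forall>w. is_root T w \<longrightarrow> fst w = t' T) \<and> (\<forall>w \<in> leaves T. fst w = 1)"
  proof (intro conjI)
    show "complete_binary_tree T" using complete_subtree_at[OF v] by (simp add: T_def)
    show "card T = 2 ^ t' T - 1"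
      using card_subtree_at[OF v] by (simp add: T_def t'_def v_def nu_def)
    show "\<forall>w. is_root T w \<longrightarrow> fst w = t' T"
      using up_subtree_at[OF v] by (auto simp: T_def t'_def up_def is_root_def v_def)
    show "\<forall>w \<in> leaves T. fst w = 1" using fst_leaves_subtree_at by (simp add: T_def)
  qed
  moreover have "complete_binary_tree T' \<and> card T' = 2 ^ t' T' - 1
          \<and> (\<forall>w. is_root T' w \<longrightarrow> fst w = t' T') \<and> (\<forall>w \<in> leaves T'. fst w = 1)" if "T' \<in> \<T>" for T'
  proof -
    have "t' T' = t T'" using that notin by (auto simp: t'_def)
    then show ?thesis using \<T>(5) that by simp
  qed
  ultimately have "p_forest (add_mset x P) (T \<union> F)"
    unfolding p_forest_def using \<T>(1,2)
    by (intro exI[of _ "insert T \<T>"] exI[of _ t']) auto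
  moreover have "\<forall>w \<in> T \<union> F. fst w < L \<and> 1 \<le> block L w \<and> block L w \<le> size (add_mset x P)"
    using T F(2) by fastforce
  ultimately show ?case by blast
qed

section \<open>The union of the C-tree and the P-forest\<close>

text \<open>Stated for disjoint greedy halves so as to serve both the SABP from
  \<open>minimal_sabp_greedy_exists\<close> and a given normal form.\<close>

lemma
  assumes min: "minimal_sabp n P N" and "0 < n"
    and disj: "P \<inter># N = {#}" and P: "P = greedy (nu_mset P)" and N: "N = greedy (nu_mset N)"
  shows union_exists: "\<exists>S. union_c_tree_p_forest P N S"
    and union_is_optimal: "union_c_tree_p_forest P N S \<Longrightarrow> optimal_subforest n S"
proof -
  define r where "r = Max_mset P"
  have s: "sabp n P N" and size: "size P + size N = tau n"
    using min by (auto simp: minimal_sabp_def)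
  then have n: "n + nu_mset N = nu_mset P" by (auto simp: sabp_def)
  with \<open>0 < n\<close> have "P \<noteq> {#}" by auto
  then have r: "r \<in># P" by (simp add: r_def)
  have r1: "1 \<le> r" using r s by (auto simp: sabp_def)
  have N_less: "i < r" if "i \<in># N" for i
  proof -
    have "nu_mset N < nu_mset P" using n \<open>0 < n\<close> by simp
    moreover have "greedy (nu_mset N) \<inter># greedy (nu_mset P) = {#}"
      unfolding P[symmetric] N[symmetric] using disj by (simp only: subset_mset.inf_commute)
    moreover have "i \<in># greedy (nu_mset N)" unfolding N[symmetric] by (rule that)
    ultimately have "i < Max_mset (greedy (nu_mset P))" by (rule Max_mset_greedy_gt)
    then show ?thesis unfolding P[symmetric] r_def .
  qed
  have ct: "c_tree_setup r N"
    using r1 N_less N by unfold_locales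
  have P_eq: "P = add_mset r (P - {#r#})" using r by simp
  show "\<exists>S. union_c_tree_p_forest P N S"
  proof -
    \<comment> \<open>Blocks are taken at level \<open>Suc r\<close>, since \<open>r\<close> may
      occur a second time in \<open>P\<close> and all trees must stay strictly below the block
      level.\<close>
    have "1 \<le> i \<and> i < Suc r" if "i \<in># P - {#r#}" for i
    proof -
      have "i \<in># P" using that by (rule in_diffD)
      then show ?thesis using s by (auto simp: sabp_def r_def less_Suc_eq_le)
    qed
    then have "\<forall>i \<in># P - {#r#}. 1 \<le> i \<and> i < Suc r" by blast
    from p_forest_exists[OF this] obtain F where F: "p_forest (P - {#r#}) F"
      "\<forall>v \<in> F. fst v < Suc r \<and> 1 \<le> block (Suc r) v" by blast
    \<comment> \<open>Placed at index 0, the C-tree lies in block 0, which the forest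
      avoids.\<close>
    have C: "fst v < Suc r" "block (Suc r) v = 0" if "v \<in> c_tree r N 0" for v
    proof -
      have v: "v \<in> subtree_at (r, 0)" using that c_tree_setup.c_tree_subset[OF ct] by blast
      show "fst v < Suc r" using subtree_at_fst_le[OF v] by simp
      show "block (Suc r) v = 0" using block_subtree_at[of v r 0 "Suc r"] v by simp
    qed
    have "separated (c_tree r N 0) F"
    proof (rule separated_blocks)
      show "fst v < Suc r" if "v \<in> c_tree r N 0 \<union> F" for v
        using that C(1) F(2) by blast
      show "block (Suc r) u \<noteq> block (Suc r) w" if "u \<in> c_tree r N 0" "w \<in> F" for u w
        using that C(2) F(2) by fastforce
    qed
    then show ?thesis using F(1) unfolding union_c_tree_p_forest_def r_def by blast
  qed
  assume "union_c_tree_p_forest P N S"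
  then obtain m F where F: "p_forest (P - {#r#}) F" "separated (c_tree r N m) F"
    "S = c_tree r N m \<union> F"
    unfolding union_c_tree_p_forest_def r_def by blast
  define C where "C = c_tree r N m"
  have C: "C \<subseteq> verts" "finite C" "card C + nu_mset N = nu r" "card (cut C) = 1 + size N"
    "is_subtree C"
    using c_tree_setup.c_tree_subset_verts[OF ct] c_tree_setup.finite_c_tree[OF ct]
      c_tree_setup.card_c_tree[OF ct] c_tree_setup.card_cut_c_tree[OF ct]
      c_tree_setup.is_subtree_c_tree[OF ct] by (auto simp: C_def)
  obtain \<T> t where \<T>: "finite \<T>" "F = \<Union>\<T>" "pairwise separated \<T>"
    "image_mset t (mset_set \<T>) = P - {#r#}"
    and complete: "\<And>T. T \<in> \<T> \<Longrightarrow> complete_binary_tree T \<and> card T = 2 ^ t T - 1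
          \<and> (\<forall>v. is_root T v \<longrightarrow> fst v = t T) \<and> (\<forall>v \<in> leaves T. fst v = 1)"
    using F(1) unfolding p_forest_def by auto
  have sub: "is_subtree T" "T \<subseteq> verts" "finite T" if "T \<in> \<T>" for T
    using complete[OF that] by (auto simp: complete_binary_tree_def is_subtree_def)
  have F_fin: "F \<subseteq> verts" "finite F" using sub \<T> by auto
  have "card F = (\<Sum>T\<in>\<T>. card T)"
    unfolding \<T>(2)
  proof (rule card_Union_disjoint)
    show "pairwise disjnt \<T>"
      using \<T>(3) by (auto simp: pairwise_def disjnt_def separated_def)
  qed (use sub in auto)
  also have "\<dots> = (\<Sum>T\<in>\<T>. nu (t T))" using complete by (simp add: nu_def)
  also have "\<dots> = nu_mset (P - {#r#})"
    unfolding \<T>(4)[symmetric]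
    by (simp add: nu_mset_def sum_unfold_sum_mset multiset.map_comp comp_def)
  finally have cardF: "card F = nu_mset (P - {#r#})" .
  have "nu_mset P = nu r + nu_mset (P - {#r#})" using P_eq by (metis nu_mset_add)
  moreover have "card S = card C + card F"
    using F C F_fin by (auto simp: C_def separated_def intro: card_Un_disjoint)
  ultimately have cardS: "card S = n" using C(3) cardF n by simp
  have "card (cut T) = 1" if "T \<in> \<T>" for T
    using complete[OF that] by (intro complete_tree_card_cut) (auto simp: nu_def)
  then have "card (cut F) = card \<T>"
    using card_cut_Union[OF \<T>(1,3)] sub \<T>(2) by simp
  also have "\<dots> = size (P - {#r#})" unfolding \<T>(4)[symmetric] by simp
  finally have "card (cut F) = size (P - {#r#})" .
  \<comment> \<open>The C-tree has \<open>1 + size N\<close> boundary edges and the forest one for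
    each of its \<open>size P - 1\<close> trees, so the total is
    \<open>size P + size N\<close>.\<close>
  moreover have "card (cut S) = card (cut C) + card (cut F)"
    using card_cut_Un[of C F] F C F_fin by (simp add: C_def)
  moreover have "size P = Suc (size (P - {#r#}))" using P_eq by (metis size_add_mset)
  ultimately have cutS: "card (cut S) = tau n" using C(4) size by simp
  have "separated C T" if "T \<in> \<T>" for T
    using F(2) \<T>(2) that unfolding C_def separated_def by blast
  then have "pairwise separated (insert C \<T>)"
    using \<T>(3) separated_sym by (auto simp: pairwise_insert)
  \<comment> \<open>The components of \<open>S\<close> are thus among \<open>C\<close> and the
    complete trees, and \<open>C\<close> is the possible exception.\<close>
  then have "trees_of (\<Union>(insert C \<T>)) \<subseteq> insert C \<T>"
    using sub C(5) by (intro trees_of_Union) auto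
  moreover have "\<Union>(insert C \<T>) = S" using F(3) \<T>(2) by (simp add: C_def)
  ultimately have "trees_of S \<subseteq> insert C \<T>" by simp
  then have "\<forall>T \<in> trees_of S. T \<noteq> C \<longrightarrow> complete_binary_tree T" using complete by blast
  moreover have "S \<subseteq> verts" "finite S" using F(3) C F_fin by (auto simp: C_def)
  ultimately show "optimal_subforest n S"
    using cardS cutS unfolding optimal_subforest_def by blast
qed

theorem theorem3p13:
  fixes n :: nat
  assumes "0 < n"
  shows "delta n = tau n
    \<and> (\<exists>S. optimal_subforest n S)
    \<and> (\<forall>P N. minimal_sabp n P N \<and> normal_form n P N \<longrightarrow>
         (\<exists>S. union_c_tree_p_forest P N S) \<and>
         (\<forall>S. union_c_tree_p_forest P N S \<longrightarrow> optimal_subforest n S))"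
proof (intro conjI allI impI)
  obtain P N where PN: "minimal_sabp n P N" "P = greedy (nu_mset P)" "N = greedy (nu_mset N)"
    using minimal_sabp_greedy_exists by blast
  note disj = minimal_sabp_disjoint[OF PN(1)]
  show ex: "\<exists>S. optimal_subforest n S"
    using union_exists[OF PN(1) assms disj PN(2,3)] union_is_optimal[OF PN(1) assms disj PN(2,3)]
    by blast
  show "delta n = tau n"
    unfolding delta_def
  \<comment> \<open>The value is attained by the optimal subforest and bounded below by
    \<open>tau_le_card_cut\<close>.\<close>
  proof (rule Least_equality)
    show "\<exists>S. S \<subseteq> verts \<and> finite S \<and> card S = n \<and> card (cut S) = tau n"
      using ex unfolding optimal_subforest_def by blast
  qed (use tau_le_card_cut in blast)
next
  fix P N assume "minimal_sabp n P N \<and> normal_form n P N"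
  then have PN: "minimal_sabp n P N" "P \<inter># N = {#}"
    "P = greedy (nu_mset P)" "N = greedy (nu_mset N)"
    by (auto simp: normal_form_def)
  show "\<exists>S. union_c_tree_p_forest P N S" using union_exists[OF PN(1) assms PN(2-4)] .
  fix S assume "union_c_tree_p_forest P N S"
  then show "optimal_subforest n S" by (rule union_is_optimal[OF PN(1) assms PN(2-4)])
qed

end
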